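(* Suppose that $\mathcal{F}\subset 2^{[n]}$ is $t$-intersecting. (i) If $n-t=2s$, then $\beta(\mathcal{F})\leq \sum_{0\leq j\leq s-1}\binom{n-2}{j}$. (ii) If $n-t=2s+1$ and $n\geq \max\{4(s+2)^2,\,36(s+7)\}$, then $\beta(\mathcal{F})\leq \binom{n-4}{s-2}+\sum_{0\leq j\leq s-1}\binom{n-2}{j}$.
   Context: $2^{[n]}$ is the power set of $[n]=\{1,\dots,n\}$. A family is $t$-intersecting if $|F\cap F'|\geq t$ for all members $F,F'$. For $\mathcal{F}\subset 2^{[n]}$ and distinct $i,j\in[n]$, let $b_{ij}(\mathcal{F})=|\{F\in\mathcal{F}\colon i\in F,\ j\notin F\}|$; the sturdiness is $\beta(\mathcal{F})=\min_{1\leq i\neq j\leq n} b_{ij}(\mathcal{F})$. Binomial coefficients with negative lower index are $0$.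
   Formalization: It is assumed that t ≥ 1 and n ≥ 2: for t = 0 part (i) fails (n = 4, s = 2, all subsets of [4] have sturdiness 4 > 3), and for n ≤ 1 the sturdiness is a minimum over an empty set. *)

theory Defs
  imports Main
begin

definition t_intersecting :: "nat \<Rightarrow> nat set set \<Rightarrow> bool" where
  "t_intersecting t \<F> \<longleftrightarrow> (\<forall>F\<in>\<F>. \<forall>F'\<in>\<F>. t \<le> card (F \<inter> F'))"

definition pair_degree :: "nat set set \<Rightarrow> nat \<Rightarrow> nat \<Rightarrow> nat" where
  "pair_degree \<F> i j = card {F \<in> \<F>. i \<in> F \<and> j \<notin> F}"

(* Only meaningful for n \<ge> 2: otherwise the minimum is over the empty set. *)
definition sturdiness :: "nat \<Rightarrow> nat set set \<Rightarrow> nat" where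
  "sturdiness n \<F> =
     Min {pair_degree \<F> i j | i j. i \<in> {1..n} \<and> j \<in> {1..n} \<and> i \<noteq> j}"

(* Integer lower index, so that s - 2 is not truncated when s < 2. *)
definition binom :: "nat \<Rightarrow> int \<Rightarrow> nat" where
  "binom m k = (if k < 0 then 0 else m choose nat k)"

end

theory Submission
  imports Defs Complex_Main
begin

text \<open>
  Passing to complements, let \<open>\<G>\<close> be a family all of whose pairwise unions have at most
  \<open>w = n - t\<close> elements. For \<open>m + l = w + 1\<close> with \<open>l < m\<close>, no \<open>l\<close>-set disjoint from an \<open>m\<close>-set of
  \<open>\<G>\<close> lies in \<open>\<G>\<close>, and Katona's intersecting shadow theorem shows that there are at least
  \<open>(n - m) / l\<close> times as many such \<open>l\<close>-sets as \<open>m\<close>-sets in \<open>\<G>\<close>. Hence the levels above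
  \<open>(w + 1) / 2\<close> contribute no more to suitably averaged pair degrees than what they exclude below.
  For even \<open>w\<close> averaging over all pairs gives (i).

  For \<open>w = 2 s + 1\<close> the middle level is an intersecting family of \<open>k\<close>-sets with \<open>k = s + 1\<close>, and one averages
  \<open>pair_degree i x\<close> over \<open>i\<close> for a well chosen \<open>x\<close> in a minimum cover. If the sets avoiding \<open>x\<close> were
  too many, then for some \<open>a\<close> in the cover the sets containing exactly one of \<open>x\<close>, \<open>a\<close> would form two
  large cross-intersecting families, which is refuted by branching over the covers of one family by
  members of the other. The only exception is a cover \<open>{x, y}\<close> where all members avoiding \<open>x\<close> share \<open>y\<close>
  and a further element \<open>z\<close>; there the average omits \<open>i = y\<close> and \<open>i = z\<close>.
\<close>

section \<open>Shadows of uniform families\<close>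

text \<open>Gaussian elimination, by induction on the equations. It supplies the linear dependency
  for the dimension argument in \<open>card_le_card_shadow\<close>.\<close>

lemma homogeneous_system_nontrivial_solution:
  fixes a :: "'e \<Rightarrow> 'u \<Rightarrow> 'f::field"
  assumes "finite E" "finite U" "card E < card U"
  shows "\<exists>c. (\<exists>u\<in>U. c u \<noteq> 0) \<and> (\<forall>e\<in>E. (\<Sum>u\<in>U. a e u * c u) = 0)"
  using assms
proof (induction E arbitrary: U a rule: finite_induct)
  case empty
  then have "U \<noteq> {}" by auto
  then show ?case by (intro exI[of _ "\<lambda>_. 1"]) auto
next
  case (insert e E)
  show ?case
  proof (cases "\<forall>u\<in>U. a e u = 0")
    case True
    obtain c where "\<exists>u\<in>U. c u \<noteq> 0" "\<forall>e\<in>E. (\<Sum>u\<in>U. a e u * c u) = 0"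
      using insert.IH[of U a] insert.prems insert.hyps by auto
    then show ?thesis using True by (intro exI[of _ c]) auto
  next
    case False
    then obtain w where w: "w \<in> U" "a e w \<noteq> 0" by auto
    \<comment> \<open>These are the coefficients left after equation \<open>e\<close> has eliminated
      the unknown \<open>w\<close>; \<open>d\<close> below reinstates \<open>w\<close> with the
      value that equation \<open>e\<close> dictates.\<close>
    define b where "b = (\<lambda>f u. a f u - a f w * a e u / a e w)"
    have "card E < card (U - {w})" using insert.prems insert.hyps w by simp
    then obtain c where c: "\<exists>u\<in>U - {w}. c u \<noteq> 0" "\<forall>f\<in>E. (\<Sum>u\<in>U - {w}. b f u * c u) = 0"
      using insert.IH[of "U - {w}" b] insert.prems by auto
    define T where "T = (\<Sum>u\<in>U - {w}. a e u * c u)"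
    define d where "d = c(w := - T / a e w)"
    have split: "(\<Sum>u\<in>U. a f u * d u) = (\<Sum>u\<in>U - {w}. a f u * c u) - a f w * T / a e w" for f
    proof -
      have "(\<Sum>u\<in>U. a f u * d u) = a f w * d w + (\<Sum>u\<in>U - {w}. a f u * d u)"
        using insert.prems w by (simp add: sum.remove)
      also have "(\<Sum>u\<in>U - {w}. a f u * d u) = (\<Sum>u\<in>U - {w}. a f u * c u)"
        by (intro sum.cong) (auto simp: d_def)
      finally show ?thesis by (simp add: d_def)
    qed
    have "(\<Sum>u\<in>U. a f u * d u) = 0" if "f \<in> E" for f
    proof -
      have "0 = (\<Sum>u\<in>U - {w}. b f u * c u)" using c that by auto
      also have "\<dots> = (\<Sum>u\<in>U - {w}. a f u * c u - a f w / a e w * (a e u * c u))"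
        by (intro sum.cong) (auto simp: b_def algebra_simps)
      also have "\<dots> = (\<Sum>u\<in>U - {w}. a f u * c u) - a f w / a e w * T"
        by (simp add: sum_subtractf sum_distrib_left T_def)
      finally show ?thesis using split[of f] by simp
    qed
    moreover have "(\<Sum>u\<in>U. a e u * d u) = 0" using split[of e] w by (simp add: T_def)
    moreover have "\<exists>u\<in>U. d u \<noteq> 0" using c by (auto simp: d_def)
    ultimately show ?thesis by (intro exI[of _ d]) auto
  qed
qed

lemma card_sets_between:
  assumes "finite X" "S \<subseteq> X" "card S \<le> k"
  shows "card {F. S \<subseteq> F \<and> F \<subseteq> X \<and> card F = k} = (card X - card S) choose (k - card S)"
proof -
  have fS: "finite S" using assms finite_subset by blast
  have "bij_betw (\<lambda>B. B \<union> S) {B. B \<subseteq> X - S \<and> card B = k - card S}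
          {F. S \<subseteq> F \<and> F \<subseteq> X \<and> card F = k}"
  proof (rule bij_betw_byWitness[where f' = "\<lambda>F. F - S"])
    show "(\<lambda>B. B \<union> S) ` {B. B \<subseteq> X - S \<and> card B = k - card S}
        \<subseteq> {F. S \<subseteq> F \<and> F \<subseteq> X \<and> card F = k}"
    proof clarify
      fix B assume B: "B \<subseteq> X - S" "card B = k - card S"
      then have "finite B" "B \<inter> S = {}" using assms finite_subset by blast+
      then have "card (B \<union> S) = k" using B assms fS by (simp add: card_Un_disjoint)
      then show "S \<subseteq> B \<union> S \<and> B \<union> S \<subseteq> X \<and> card (B \<union> S) = k" using B assms by auto
    qed
    show "(\<lambda>F. F - S) ` {F. S \<subseteq> F \<and> F \<subseteq> X \<and> card F = k}
        \<subseteq> {B. B \<subseteq> X - S \<and> card B = k - card S}"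
      using fS by (auto simp: card_Diff_subset)
  qed auto
  then have "card {F. S \<subseteq> F \<and> F \<subseteq> X \<and> card F = k}
      = card {B. B \<subseteq> X - S \<and> card B = k - card S}"
    by (simp add: bij_betw_same_card)
  also have "\<dots> = card (X - S) choose (k - card S)" using assms by (simp add: n_subsets)
  also have "card (X - S) = card X - card S" using assms fS by (simp add: card_Diff_subset)
  finally show ?thesis .
qed

lemma sum_card_containing:
  assumes "finite V" "finite \<D>"
  shows "(\<Sum>v\<in>V. card {D\<in>\<D>. v \<in> D}) = (\<Sum>D\<in>\<D>. card (D \<inter> V))"
proof -
  have "(\<Sum>v\<in>V. card {D\<in>\<D>. v \<in> D}) = (\<Sum>v\<in>V. \<Sum>D\<in>\<D>. if v \<in> D then 1 else 0)"
    using assms by (intro sum.cong) (auto simp: sum.If_cases Int_def)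
  also have "\<dots> = (\<Sum>D\<in>\<D>. \<Sum>v\<in>V. if v \<in> D then 1 else 0)" by (rule sum.swap)
  also have "\<dots> = (\<Sum>D\<in>\<D>. card (D \<inter> V))"
    using assms by (intro sum.cong) (auto simp: sum.If_cases Int_commute)
  finally show ?thesis .
qed

text \<open>A dimension argument: were the shadow smaller, some nonzero weighting \<open>c\<close>
  of \<open>\<F>\<close> would have total weight zero above every \<open>l\<close>-set. By
  \<open>diff\<close>, the other members meet \<open>F0\<close> in one of only \<open>l\<close>
  possible sizes, so a polynomial of degree \<open>l\<close> in that size isolates
  \<open>c F0\<close>.\<close>

lemma card_le_card_shadow:
  fixes \<F> :: "'a set set"
  assumes fin: "finite \<F>"
    and unif: "\<And>F. F \<in> \<F> \<Longrightarrow> finite F \<and> card F = k"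
    and diff: "\<And>F F'. F \<in> \<F> \<Longrightarrow> F' \<in> \<F> \<Longrightarrow> card (F - F') \<le> l"
    and lk: "l \<le> k"
  shows "card \<F> \<le> card {D. card D = l \<and> (\<exists>F\<in>\<F>. D \<subseteq> F)}"
proof (rule ccontr)
  let ?\<S> = "{D. card D = l \<and> (\<exists>F\<in>\<F>. D \<subseteq> F)}"
  define ind :: "'a set \<Rightarrow> 'a set \<Rightarrow> real" where "ind = (\<lambda>D F. if D \<subseteq> F then 1 else 0)"
  assume "\<not> ?thesis"
  then have lt: "card ?\<S> < card \<F>" by simp
  have finS: "finite ?\<S>"
    by (rule finite_subset[of _ "Pow (\<Union>\<F>)"]) (use fin unif in auto)
  obtain c where c: "\<exists>F\<in>\<F>. c F \<noteq> 0" "\<And>D. D \<in> ?\<S> \<Longrightarrow> (\<Sum>F\<in>\<F>. ind D F * c F) = 0"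
    using homogeneous_system_nontrivial_solution[OF finS fin lt, of ind] by blast
  obtain F0 where F0: "F0 \<in> \<F>" "c F0 \<noteq> 0" using c by auto
  have finV: "finite (\<Union>\<F>)" using fin unif by auto
  \<comment> \<open>Double counting passes the vanishing down from \<open>l\<close>-sets to smaller
    \<open>D\<close>: every member containing \<open>D\<close> contains the same number of
    \<open>l\<close>-sets above \<open>D\<close>, nonzero because \<open>l <= k\<close>.\<close>
  have low: "(\<Sum>F\<in>\<F>. ind D F * c F) = 0" if D: "finite D" "card D \<le> l" for D
  proof -
    let ?T = "{E. E \<subseteq> \<Union>\<F> \<and> D \<subseteq> E \<and> card E = l}"
    have finT: "finite ?T" by (rule finite_subset[of _ "Pow (\<Union>\<F>)"]) (use finV in auto)
    have zero: "(\<Sum>F\<in>\<F>. ind E F * c F) = 0" if "E \<in> ?T" for E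
    proof (cases "E \<in> ?\<S>")
      case False
      then have "ind E F = 0" if "F \<in> \<F>" for F using that \<open>E \<in> ?T\<close> by (auto simp: ind_def)
      then show ?thesis by simp
    qed (use c in auto)
    have cnt: "(\<Sum>E\<in>?T. ind E F) = real ((k - card D) choose (l - card D)) * ind D F"
      if F: "F \<in> \<F>" for F
    proof -
      have "(\<Sum>E\<in>?T. ind E F) = real (card {E\<in>?T. E \<subseteq> F})"
        using finT by (simp add: ind_def sum.If_cases Int_def)
      also have "{E\<in>?T. E \<subseteq> F} = {E. D \<subseteq> E \<and> E \<subseteq> F \<and> card E = l}" using F by auto
      also have "real (card \<dots>) = real ((k - card D) choose (l - card D)) * ind D F"
      proof (cases "D \<subseteq> F")
        case True
        then show ?thesis using card_sets_between[of F D l] unif[OF F] D by (simp add: ind_def)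
      next
        case False
        then have "{E. D \<subseteq> E \<and> E \<subseteq> F \<and> card E = l} = {}" by auto
        then show ?thesis using False by (simp add: ind_def del: Collect_empty_eq)
      qed
      finally show ?thesis .
    qed
    have "0 = (\<Sum>E\<in>?T. \<Sum>F\<in>\<F>. ind E F * c F)" using zero by simp
    also have "\<dots> = (\<Sum>F\<in>\<F>. \<Sum>E\<in>?T. ind E F * c F)" by (rule sum.swap)
    also have "\<dots> = (\<Sum>F\<in>\<F>. (\<Sum>E\<in>?T. ind E F) * c F)" by (simp add: sum_distrib_right)
    also have "\<dots> = real ((k - card D) choose (l - card D)) * (\<Sum>F\<in>\<F>. ind D F * c F)"
      using cnt by (simp add: sum_distrib_left mult.assoc)
    finally show ?thesis using binomial_eq_0_iff[of "k - card D" "l - card D"] lk D by auto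
  qed
  define p where "p = (\<lambda>F. card (F0 \<inter> F))"
  have fF0: "finite F0" "card F0 = k" using unif F0 by auto
  \<comment> \<open>This sums \<open>low\<close> over the \<open>i\<close>-subsets of
    \<open>F0\<close>.\<close>
  have binom0: "(\<Sum>F\<in>\<F>. c F * real (p F choose i)) = 0" if "i \<le> l" for i
  proof -
    let ?T = "{D. D \<subseteq> F0 \<and> card D = i}"
    have finT: "finite ?T" using fF0 by auto
    have "(\<Sum>D\<in>?T. ind D F) = real (p F choose i)" for F
    proof -
      have "(\<Sum>D\<in>?T. ind D F) = real (card {D\<in>?T. D \<subseteq> F})"
        using finT by (simp add: ind_def sum.If_cases Int_def)
      also have "{D\<in>?T. D \<subseteq> F} = {D. D \<subseteq> F0 \<inter> F \<and> card D = i}" by auto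
      also have "card \<dots> = p F choose i"
        unfolding p_def by (rule n_subsets) (use fF0 in auto)
      finally show ?thesis .
    qed
    then have "(\<Sum>F\<in>\<F>. c F * real (p F choose i)) = (\<Sum>F\<in>\<F>. \<Sum>D\<in>?T. ind D F * c F)"
      by (simp add: mult.commute flip: sum_distrib_left)
    also have "\<dots> = (\<Sum>D\<in>?T. \<Sum>F\<in>\<F>. ind D F * c F)" by (rule sum.swap)
    also have "\<dots> = 0"
    proof (rule sum.neutral, rule ballI)
      fix D assume "D \<in> ?T"
      then show "(\<Sum>F\<in>\<F>. ind D F * c F) = 0"
        using that fF0 by (intro low) (auto intro: finite_subset)
    qed
    finally show ?thesis .
  qed
  \<comment> \<open>A binomial of index \<open>i\<close> times a linear factor in \<open>p F\<close>
    is a combination of binomials of index \<open>i\<close> and \<open>Suc i\<close>, so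
    \<open>j\<close> factors raise the index by at most \<open>j\<close>.\<close>
  have poly0: "(\<Sum>F\<in>\<F>. c F * real (p F choose i) * (\<Prod>m<j. real (p F) - e m)) = 0"
    if "i + j \<le> l" for i j and e :: "nat \<Rightarrow> real"
    using that
  proof (induction j arbitrary: i)
    case 0
    then show ?case using binom0 by simp
  next
    case (Suc j)
    have step: "real (q choose i) * (real q - y)
        = real (Suc i) * real (q choose Suc i) + (real i - y) * real (q choose i)" for q y
    proof -
      have "Suc i * (q choose Suc i) + i * (q choose i) = q * (q choose i)"
      proof (cases "i \<le> q")
        case True
        have "Suc i * (q choose Suc i) = (q - i) * (q choose i)"
          unfolding binomial_absorption binomial_absorb_comp ..
        then have "Suc i * (q choose Suc i) + i * (q choose i) = (q - i + i) * (q choose i)"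
          by (simp only: add_mult_distrib)
        then show ?thesis using True by simp
      qed (simp add: binomial_eq_0)
      then have "real (Suc i) * real (q choose Suc i) + real i * real (q choose i)
          = real q * real (q choose i)"
        by (metis of_nat_add of_nat_mult)
      then show ?thesis by (simp add: algebra_simps)
    qed
    have "(\<Sum>F\<in>\<F>. c F * real (p F choose i) * (\<Prod>m<Suc j. real (p F) - e m))
      = (\<Sum>F\<in>\<F>. c F * (real (p F choose i) * (real (p F) - e j)) * (\<Prod>m<j. real (p F) - e m))"
      by (simp add: mult_ac)
    also have "\<dots> = real (Suc i) * (\<Sum>F\<in>\<F>. c F * real (p F choose Suc i) * (\<Prod>m<j. real (p F) - e m))
        + (real i - e j) * (\<Sum>F\<in>\<F>. c F * real (p F choose i) * (\<Prod>m<j. real (p F) - e m))"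
      unfolding step by (simp only: sum_distrib_left sum.distrib[symmetric])
        (intro sum.cong, auto simp: algebra_simps)
    also have "\<dots> = 0" using Suc.IH[of "Suc i"] Suc.IH[of i] Suc.prems by simp
    finally show ?case .
  qed
  \<comment> \<open>This polynomial in \<open>card (F0 \<inter> F)\<close> vanishes at all intersection sizes of distinct members.\<close>
  let ?g = "\<lambda>F. \<Prod>m<l. real (p F) - (real k - 1 - real m)"
  have "?g F = 0" if F: "F \<in> \<F>" "F \<noteq> F0" for F
  proof -
    let ?u = "card (F0 - F)"
    have "\<not> F0 \<subseteq> F" using F unif[OF F(1)] fF0 card_subset_eq[of F F0] by auto
    then have pos: "?u > 0" using fF0 by (simp add: card_gt_0_iff)
    have le: "?u \<le> l" using diff F F0 by auto
    have "card F0 = card (F0 \<inter> F) + ?u"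
      using fF0 by (metis Int_Diff_Un Int_Diff_disjoint card_Un_disjoint finite_Diff finite_Int)
    then have "p F + ?u = k" using fF0 by (simp add: p_def)
    \<comment> \<open>The factor with index \<open>?u - 1\<close> is the one that vanishes, as
      \<open>F\<close> meets \<open>F0\<close> in \<open>k - ?u\<close> elements.\<close>
    then have "real (p F) - (real k - 1 - real (?u - 1)) = 0" using pos by simp
    then show ?thesis using pos le by (intro prod_zero) (auto intro!: bexI[of _ "?u - 1"])
  qed
  then have "(\<Sum>F\<in>\<F>. c F * ?g F) = c F0 * ?g F0"
    using fin F0 by (subst sum.remove[of _ F0]) (auto simp del: prod_zero_iff)
  moreover have "(\<Sum>F\<in>\<F>. c F * ?g F) = 0" using poly0[of 0 l] by simp
  \<comment> \<open>At \<open>F0\<close> the factors are 1, ..., \<open>l\<close>.\<close>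
  moreover have "?g F0 \<noteq> 0" using fF0 by (auto simp: p_def)
  ultimately show False using F0 by simp
qed

text \<open>Applying the previous bound to all links and summing gains the factor \<open>k / l\<close>.\<close>

lemma uniform_card_le_shadow:
  fixes \<F> :: "'a set set"
  assumes fin: "finite \<F>"
    and unif: "\<And>F. F \<in> \<F> \<Longrightarrow> finite F \<and> card F = k"
    and diff: "\<And>F F'. F \<in> \<F> \<Longrightarrow> F' \<in> \<F> \<Longrightarrow> card (F - F') < l"
    and l: "1 \<le> l" "l \<le> k"
  shows "k * card \<F> \<le> l * card {D. card D = l \<and> (\<exists>F\<in>\<F>. D \<subseteq> F)}"
proof -
  let ?\<S> = "{D. card D = l \<and> (\<exists>F\<in>\<F>. D \<subseteq> F)}" and ?V = "\<Union>\<F>"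
  have finV: "finite ?V" using fin unif by auto
  have finS: "finite ?\<S>" by (rule finite_subset[of _ "Pow ?V"]) (use finV in auto)
  have link: "card {F\<in>\<F>. v \<in> F} \<le> card {D\<in>?\<S>. v \<in> D}" for v
  proof -
    \<comment> \<open>Deleting \<open>v\<close> lowers the set size and the shadow level by one but
      preserves differences, so the strict bound in \<open>diff\<close> is exactly the weak one
      needed for the link.\<close>
    let ?L = "(\<lambda>F. F - {v}) ` {F\<in>\<F>. v \<in> F}"
    have "inj_on (\<lambda>F. F - {v}) {F\<in>\<F>. v \<in> F}" by (auto simp: inj_on_def)
    then have "card {F\<in>\<F>. v \<in> F} = card ?L" by (simp add: card_image)
    also have "\<dots> \<le> card {E. card E = l - 1 \<and> (\<exists>F\<in>?L. E \<subseteq> F)}"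
    proof (rule card_le_card_shadow)
      show "card (F - F') \<le> l - 1" if FF: "F \<in> ?L" "F' \<in> ?L" for F F'
      proof -
        obtain A B where AB: "A \<in> \<F>" "B \<in> \<F>" "v \<in> A" "v \<in> B" "F = A - {v}" "F' = B - {v}"
          using FF by auto
        then have "F - F' = A - B" by auto
        then show ?thesis using diff[of A B] AB by auto
      qed
    qed (use fin unif l in auto)
    also have "\<dots> \<le> card {D\<in>?\<S>. v \<in> D}"
    proof (rule card_inj_on_le[where f = "insert v"])
      show "inj_on (insert v) {E. card E = l - 1 \<and> (\<exists>F\<in>?L. E \<subseteq> F)}"
      proof (rule inj_onI)
        fix E E' assume E: "E \<in> {E. card E = l - 1 \<and> (\<exists>F\<in>?L. E \<subseteq> F)}"
          "E' \<in> {E. card E = l - 1 \<and> (\<exists>F\<in>?L. E \<subseteq> F)}" and eq: "insert v E = insert v E'"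
        have "v \<notin> E" "v \<notin> E'" using E by blast+
        then show "E = E'" using eq by (simp add: insert_ident)
      qed
      show "insert v ` {E. card E = l - 1 \<and> (\<exists>F\<in>?L. E \<subseteq> F)} \<subseteq> {D\<in>?\<S>. v \<in> D}"
      proof
        fix D assume "D \<in> insert v ` {E. card E = l - 1 \<and> (\<exists>F\<in>?L. E \<subseteq> F)}"
        then obtain E A where E: "D = insert v E" "card E = l - 1" "E \<subseteq> A - {v}"
          and A: "A \<in> \<F>" "v \<in> A"
          by blast
        then have "finite E" "v \<notin> E" using unif[OF A(1)] finite_subset by auto
        then have "card D = l" using E l by simp
        then show "D \<in> {D\<in>?\<S>. v \<in> D}" using A E by auto
      qed
      show "finite {D\<in>?\<S>. v \<in> D}" by (rule finite_subset[OF _ finS]) auto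
    qed
    finally show ?thesis .
  qed
  have "k * card \<F> = (\<Sum>F\<in>\<F>. card (F \<inter> ?V))"
  proof -
    have "card (F \<inter> ?V) = k" if "F \<in> \<F>" for F
      using unif[OF that] that by (simp add: Int_absorb2 Union_upper)
    then show ?thesis by simp
  qed
  also have "\<dots> = (\<Sum>v\<in>?V. card {F\<in>\<F>. v \<in> F})" by (rule sum_card_containing[OF finV fin, symmetric])
  also have "\<dots> \<le> (\<Sum>v\<in>?V. card {D\<in>?\<S>. v \<in> D})" by (intro sum_mono link)
  also have "\<dots> = (\<Sum>D\<in>?\<S>. card (D \<inter> ?V))" by (rule sum_card_containing[OF finV finS])
  also have "\<dots> = (\<Sum>D\<in>?\<S>. l)"
    by (intro sum.cong) (auto intro!: arg_cong[where f = card])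
  also have "\<dots> = l * card ?\<S>" by simp
  finally show ?thesis .
qed

text \<open>Complements in \<open>X\<close> have \<open>card X - m\<close> elements and differences
  below \<open>l\<close>, and the \<open>l\<close>-sets in their shadow are those disjoint from a
  member of \<open>\<G>\<close>.\<close>

lemma card_le_card_disjoint_sets:
  fixes \<G> :: "'a set set"
  assumes X: "finite X" and sub: "\<And>G. G \<in> \<G> \<Longrightarrow> G \<subseteq> X \<and> card G = m"
    and un: "\<And>G G'. G \<in> \<G> \<Longrightarrow> G' \<in> \<G> \<Longrightarrow> card (G \<union> G') < m + l"
    and l: "1 \<le> l" "m + l \<le> card X"
  shows "(card X - m) * card \<G> \<le> l * card {D. D \<subseteq> X \<and> card D = l \<and> (\<exists>G\<in>\<G>. D \<inter> G = {})}"
proof -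
  have finG: "finite \<G>" by (rule finite_subset[of _ "Pow X"]) (use X sub in auto)
  have finm: "finite G" if "G \<in> \<G>" for G using sub[OF that] X finite_subset by auto
  have "(card X - m) * card ((\<lambda>G. X - G) ` \<G>)
      \<le> l * card {D. card D = l \<and> (\<exists>F\<in>(\<lambda>G. X - G) ` \<G>. D \<subseteq> F)}"
  proof (rule uniform_card_le_shadow)
    show "finite F \<and> card F = card X - m" if "F \<in> (\<lambda>G. X - G) ` \<G>" for F
      using that X sub finm by (auto simp: card_Diff_subset)
    show "card (F - F') < l" if FF: "F \<in> (\<lambda>G. X - G) ` \<G>" "F' \<in> (\<lambda>G. X - G) ` \<G>" for F F'
    proof -
      obtain G G' where G: "G \<in> \<G>" "G' \<in> \<G>" "F = X - G" "F' = X - G'" using FF by auto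
      have "F - F' = (G \<union> G') - G" using G sub by auto
      then have "card (F - F') = card (G \<union> G') - m" using G finm sub by (simp add: card_Diff_subset)
      then show ?thesis using un[of G G'] G l by simp
    qed
  qed (use finG l in auto)
  moreover have "inj_on (\<lambda>G. X - G) \<G>" using sub by (intro inj_onI) blast
  moreover have "{D. card D = l \<and> (\<exists>F\<in>(\<lambda>G. X - G) ` \<G>. D \<subseteq> F)}
      = {D. D \<subseteq> X \<and> card D = l \<and> (\<exists>G\<in>\<G>. D \<inter> G = {})}"
    by auto
  ultimately show ?thesis by (simp add: card_image)
qed

section \<open>Averaging pair degrees\<close>

text \<open>Level \<open>m\<close> above the middle is charged to level \<open>w + 1 - m\<close>: a
  set there that is disjoint from an \<open>m\<close>-member cannot belong to \<open>\<G>\<close>,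
  since the union would have \<open>w + 1\<close> elements. Only a level paired with itself remains
  uncharged.\<close>

lemma sum_pairing_levels:
  fixes \<G> :: "'a set set" and wt :: "'a set \<Rightarrow> nat"
  assumes X: "finite X" and sub: "\<G> \<subseteq> Pow X"
    and un: "\<And>G G'. G \<in> \<G> \<Longrightarrow> G' \<in> \<G> \<Longrightarrow> card (G \<union> G') \<le> w"
    and pair: "\<And>m l. l < m \<Longrightarrow> 1 \<le> l \<Longrightarrow> m + l = w + 1 \<Longrightarrow>
        (\<Sum>G | G \<in> \<G> \<and> card G = m. wt G)
          \<le> (\<Sum>D | D \<subseteq> X \<and> card D = l \<and> (\<exists>G\<in>\<G>. card G = m \<and> D \<inter> G = {}). wt D)"
  shows "(\<Sum>G | G \<in> \<G> \<and> 2 * card G \<noteq> w + 1. wt G) \<le> (\<Sum>D | D \<subseteq> X \<and> 2 * card D \<le> w. wt D)"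
proof -
  let ?miss = "\<lambda>m. {D. D \<subseteq> X \<and> card D = w + 1 - m \<and> (\<exists>G\<in>\<G>. card G = m \<and> D \<inter> G = {})}"
  let ?L = "{G\<in>\<G>. 2 * card G \<le> w}" and ?U = "{G\<in>\<G>. w + 1 < 2 * card G}"
  \<comment> \<open>Applying \<open>un\<close> to two equal members shows that the levels end at
    \<open>w\<close>, so the partner level \<open>w + 1 - m\<close> is at least 1.\<close>
  let ?M = "{m. w + 1 < 2 * m \<and> m \<le> w}"
  have finG: "finite \<G>" using X sub finite_subset by blast
  have fing: "finite G" if "G \<in> \<G>" for G using that X sub finite_subset by blast
  have finM: "finite ?M" by (rule finite_subset[of _ "{..w}"]) auto
  have finmiss: "finite (?miss m)" for m by (rule finite_subset[of _ "Pow X"]) (use X in auto)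
  have "sum wt ?U = (\<Sum>m\<in>?M. \<Sum>G | G \<in> ?U \<and> card G = m. wt G)"
    using finG finM un[of G G for G] by (subst sum.group) auto
  also have "\<dots> = (\<Sum>m\<in>?M. \<Sum>G | G \<in> \<G> \<and> card G = m. wt G)"
    by (intro sum.cong) auto
  also have "\<dots> \<le> (\<Sum>m\<in>?M. sum wt (?miss m))"
  proof (rule sum_mono)
    fix m assume "m \<in> ?M"
    then show "(\<Sum>G | G \<in> \<G> \<and> card G = m. wt G) \<le> sum wt (?miss m)"
      by (intro pair) auto
  qed
  also have "\<dots> = sum wt (\<Union>m\<in>?M. ?miss m)"
    using finM finmiss by (subst sum.UNION_disjoint) auto
  finally have U: "sum wt ?U \<le> sum wt (\<Union>m\<in>?M. ?miss m)" .
  have disj: "?L \<inter> (\<Union>m\<in>?M. ?miss m) = {}"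
  proof (rule ccontr)
    assume "\<not> ?thesis"
    then obtain D m G where D: "D \<in> \<G>" "m \<in> ?M" "card D = w + 1 - m" "G \<in> \<G>" "card G = m" "D \<inter> G = {}"
      by blast
    then have "card (D \<union> G) = w + 1" using fing by (simp add: card_Un_disjoint)
    then show False using un[of D G] D by simp
  qed
  have "{G. G \<in> \<G> \<and> 2 * card G \<noteq> w + 1} = ?L \<union> ?U" by auto
  then have "(\<Sum>G | G \<in> \<G> \<and> 2 * card G \<noteq> w + 1. wt G) = sum wt ?L + sum wt ?U"
    using finG by (simp, subst sum.union_disjoint) auto
  also have "\<dots> \<le> sum wt ?L + sum wt (\<Union>m\<in>?M. ?miss m)" using U by simp
  also have "\<dots> = sum wt (?L \<union> (\<Union>m\<in>?M. ?miss m))"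
    using finG finM finmiss disj by (subst sum.union_disjoint) auto
  also have "\<dots> \<le> (\<Sum>D | D \<subseteq> X \<and> 2 * card D \<le> w. wt D)"
    by (rule sum_mono2) (use X sub in auto)
  finally show ?thesis .
qed

lemma sum_pair_degree_fixed:
  assumes "finite I" "finite \<G>" "x \<notin> I"
  shows "(\<Sum>i\<in>I. pair_degree \<G> i x) = (\<Sum>G | G \<in> \<G> \<and> x \<notin> G. card (G \<inter> I))"
proof -
  have "(\<Sum>i\<in>I. pair_degree \<G> i x) = (\<Sum>i\<in>I. card {G\<in>{G\<in>\<G>. x \<notin> G}. i \<in> G})"
    unfolding pair_degree_def by (intro sum.cong refl arg_cong[where f = card]) auto
  also have "\<dots> = (\<Sum>G | G \<in> \<G> \<and> x \<notin> G. card (G \<inter> I))"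
    using assms by (subst sum_card_containing) auto
  finally show ?thesis .
qed

text \<open>Each \<open>G\<close> is counted once for every \<open>i\<close> inside and every
  \<open>x\<close> outside it.\<close>

lemma sum_pair_degree:
  assumes "finite X" "\<G> \<subseteq> Pow X"
  shows "(\<Sum>x\<in>X. \<Sum>i\<in>X - {x}. pair_degree \<G> i x) = (\<Sum>G\<in>\<G>. card G * (card X - card G))"
proof -
  have finG: "finite \<G>" using assms finite_subset by blast
  have "(\<Sum>x\<in>X. \<Sum>i\<in>X - {x}. pair_degree \<G> i x)
      = (\<Sum>x\<in>X. \<Sum>G | G \<in> \<G> \<and> x \<notin> G. card (G \<inter> (X - {x})))"
    using assms finG by (simp add: sum_pair_degree_fixed)
  also have "\<dots> = (\<Sum>x\<in>X. \<Sum>G\<in>\<G>. if x \<notin> G then card G else 0)"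
  proof (rule sum.cong[OF refl])
    fix x assume "x \<in> X"
    have "(\<Sum>G | G \<in> \<G> \<and> x \<notin> G. card (G \<inter> (X - {x}))) = (\<Sum>G | G \<in> \<G> \<and> x \<notin> G. card G)"
    proof (intro sum.cong refl)
      fix G assume "G \<in> {G. G \<in> \<G> \<and> x \<notin> G}"
      then have "G \<inter> (X - {x}) = G" using assms by auto
      then show "card (G \<inter> (X - {x})) = card G" by simp
    qed
    then show "(\<Sum>G | G \<in> \<G> \<and> x \<notin> G. card (G \<inter> (X - {x}))) = (\<Sum>G\<in>\<G>. if x \<notin> G then card G else 0)"
      using finG by (simp add: sum.inter_filter)
  qed
  also have "\<dots> = (\<Sum>G\<in>\<G>. \<Sum>x\<in>X. if x \<notin> G then card G else 0)" by (rule sum.swap)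
  also have "\<dots> = (\<Sum>G\<in>\<G>. card G * (card X - card G))"
  proof (rule sum.cong[OF refl])
    fix G assume "G \<in> \<G>"
    then have G: "G \<subseteq> X" using assms by auto
    then have "finite G" using assms by (blast intro: finite_subset)
    have "(\<Sum>x\<in>X. if x \<notin> G then card G else 0) = (\<Sum>x\<in>X - G. card G)"
      using assms by (intro sum.mono_neutral_cong_right) auto
    then show "(\<Sum>x\<in>X. if x \<notin> G then card G else 0) = card G * (card X - card G)"
      using G \<open>finite G\<close> by (simp add: card_Diff_subset)
  qed
  finally show ?thesis .
qed

text \<open>Such a set consists of \<open>i\<close> and \<open>j < s\<close> of the
  \<open>card X - 2\<close> elements other than \<open>i\<close> and \<open>x\<close>. This realises
  the binomial sum of both bounds as a pair degree, so that families can be compared with all sets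
  of at most \<open>s\<close> elements.\<close>

lemma pair_degree_bounded_sets:
  assumes "finite X" "i \<in> X" "x \<in> X" "i \<noteq> x"
  shows "pair_degree {D. D \<subseteq> X \<and> card D \<le> s} i x = (\<Sum>j<s. (card X - 2) choose j)"
proof -
  let ?T = "{F. F \<subseteq> X - {x} \<and> i \<in> F \<and> card F \<le> s}"
  have "{F \<in> {D. D \<subseteq> X \<and> card D \<le> s}. i \<in> F \<and> x \<notin> F}
      = (\<Union>j<s. {F. {i} \<subseteq> F \<and> F \<subseteq> X - {x} \<and> card F = Suc j})"
  proof (intro equalityI subsetI)
    fix F assume F: "F \<in> {F \<in> {D. D \<subseteq> X \<and> card D \<le> s}. i \<in> F \<and> x \<notin> F}"
    then have "finite F" using assms finite_subset by auto
    then have "card F > 0" using F by (auto simp: card_gt_0_iff)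
    then show "F \<in> (\<Union>j<s. {F. {i} \<subseteq> F \<and> F \<subseteq> X - {x} \<and> card F = Suc j})"
      using F by (intro UN_I[of "card F - 1"]) auto
  qed auto
  then have "pair_degree {D. D \<subseteq> X \<and> card D \<le> s} i x
      = card (\<Union>j<s. {F. {i} \<subseteq> F \<and> F \<subseteq> X - {x} \<and> card F = Suc j})"
    by (simp add: pair_degree_def)
  also have "\<dots> = (\<Sum>j<s. card {F. {i} \<subseteq> F \<and> F \<subseteq> X - {x} \<and> card F = Suc j})"
    using assms by (intro card_UN_disjoint)
      (auto intro!: finite_subset[of _ "Pow X"])
  also have "\<dots> = (\<Sum>j<s. (card X - 2) choose j)"
  proof (intro sum.cong refl)
    fix j
    show "card {F. {i} \<subseteq> F \<and> F \<subseteq> X - {x} \<and> card F = Suc j} = (card X - 2) choose j"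
      using card_sets_between[of "X - {x}" "{i}" "Suc j"] assms by (simp add: numeral_2_eq_2)
  qed
  finally show ?thesis .
qed

lemma exists_pair_degree_le_even:
  fixes \<G> :: "nat set set"
  assumes X: "finite X" and sub: "\<G> \<subseteq> Pow X"
    and un: "\<And>G G'. G \<in> \<G> \<Longrightarrow> G' \<in> \<G> \<Longrightarrow> card (G \<union> G') \<le> 2 * s"
    and n: "2 \<le> card X" "2 * s < card X"
  shows "\<exists>i\<in>X. \<exists>x\<in>X. i \<noteq> x \<and> pair_degree \<G> i x \<le> (\<Sum>j<s. (card X - 2) choose j)"
proof (rule ccontr)
  assume "\<not> ?thesis"
  then have big: "(\<Sum>j<s. (card X - 2) choose j) < pair_degree \<G> i x" if "i \<in> X" "x \<in> X" "i \<noteq> x" for i x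
    using that by force
  let ?B = "{D. D \<subseteq> X \<and> card D \<le> s}" and ?wt = "\<lambda>G. card G * (card X - card G)"
  have ne: "X \<noteq> {}" "X - {x} \<noteq> {}" for x
  proof -
    show "X - {x} \<noteq> {}"
    proof
      assume "X - {x} = {}"
      then have "card X \<le> card {x}" by (intro card_mono) auto
      then show False using n by simp
    qed
  qed (use n in auto)
  have "(\<Sum>x\<in>X. \<Sum>i\<in>X - {x}. pair_degree ?B i x) < (\<Sum>x\<in>X. \<Sum>i\<in>X - {x}. pair_degree \<G> i x)"
    using X ne big by (intro sum_strict_mono) (auto simp: pair_degree_bounded_sets)
  then have "sum ?wt ?B < sum ?wt \<G>"
    using sum_pair_degree[OF X sub] sum_pair_degree[OF X, of ?B] by (simp add: Collect_mono Pow_def)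
  moreover have "(\<Sum>G | G \<in> \<G> \<and> 2 * card G \<noteq> 2 * s + 1. ?wt G) \<le> (\<Sum>D | D \<subseteq> X \<and> 2 * card D \<le> 2 * s. ?wt D)"
  proof (rule sum_pairing_levels[OF X sub un])
    fix m l assume ml: "l < m" "1 \<le> l" "m + l = 2 * s + 1"
    let ?Gm = "{G. G \<in> \<G> \<and> card G = m}"
    let ?miss = "{D. D \<subseteq> X \<and> card D = l \<and> (\<exists>G\<in>?Gm. D \<inter> G = {})}"
    have "(card X - m) * card ?Gm \<le> l * card ?miss"
    proof (rule card_le_card_disjoint_sets[OF X])
      show "card (G \<union> G') < m + l" if "G \<in> ?Gm" "G' \<in> ?Gm" for G G'
        using un[of G G'] that ml by simp
    qed (use sub ml n in auto)
    \<comment> \<open>Completes both sides to the weights \<open>m * (card X - m)\<close> and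
      \<open>l * (card X - l)\<close>; here \<open>m <= card X - l\<close> because
      \<open>m + l = 2 * s + 1 <= card X\<close>.\<close>
    then have "m * ((card X - m) * card ?Gm) \<le> (card X - l) * (l * card ?miss)"
      using ml n by (intro mult_mono[of m "card X - l"]) auto
    moreover have "?miss = {D. D \<subseteq> X \<and> card D = l \<and> (\<exists>G\<in>\<G>. card G = m \<and> D \<inter> G = {})}"
      by auto
    ultimately show "sum ?wt ?Gm \<le> (\<Sum>D | D \<subseteq> X \<and> card D = l \<and> (\<exists>G\<in>\<G>. card G = m \<and> D \<inter> G = {}). ?wt D)"
      by (simp add: mult_ac)
  qed
  \<comment> \<open>By parity no level is its own partner.\<close>
  moreover have "{G. G \<in> \<G> \<and> 2 * card G \<noteq> 2 * s + 1} = \<G>" by auto presburger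
  ultimately show False by simp
qed

section \<open>Uniform intersecting families\<close>

text \<open>While the current set misses some \<open>H\<close>, every member above it contains one
  of the at most \<open>h\<close> elements of \<open>H\<close>, and adding that element starts a
  branch. After \<open>d\<close> rounds each branch counts all \<open>k\<close>-sets of
  \<open>X\<close> above its set.\<close>

lemma card_containing_le_branching:
  fixes \<C> \<H> :: "'a set set"
  assumes X: "finite X"
    and C: "\<And>F. F \<in> \<C> \<Longrightarrow> F \<subseteq> X \<and> card F = k"
    and H: "\<And>H. H \<in> \<H> \<Longrightarrow> finite H \<and> card H \<le> h"
    and meet: "\<And>F H. F \<in> \<C> \<Longrightarrow> H \<in> \<H> \<Longrightarrow> F \<inter> H \<noteq> {}"
    and S: "finite S"
    and avoid: "\<And>T. S \<subseteq> T \<Longrightarrow> finite T \<Longrightarrow> card T < card S + d \<Longrightarrow> \<exists>H\<in>\<H>. T \<inter> H = {}"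
  shows "card {F\<in>\<C>. S \<subseteq> F} \<le> h ^ d * ((card X - (card S + d)) choose (k - (card S + d)))"
  using S avoid
proof (induction d arbitrary: S)
  case 0
  show ?case
  proof (cases "{F\<in>\<C>. S \<subseteq> F} = {}")
    case False
    then obtain F where F: "F \<in> \<C>" "S \<subseteq> F" by auto
    then have S: "S \<subseteq> X" "card S \<le> k"
      using C[OF F(1)] X by (auto intro: card_mono finite_subset)
    have "card {F\<in>\<C>. S \<subseteq> F} \<le> card {F. S \<subseteq> F \<and> F \<subseteq> X \<and> card F = k}"
      by (rule card_mono) (use C X in \<open>auto intro: finite_subset[of _ "Pow X"]\<close>)
    then show ?thesis using card_sets_between[OF X S] by simp
  qed (simp del: Collect_empty_eq)
next
  case (Suc d)
  obtain H0 where H0: "H0 \<in> \<H>" "S \<inter> H0 = {}" using Suc.prems(2)[of S] Suc.prems(1) by auto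
  have fC: "finite \<C>" by (rule finite_subset[of _ "Pow X"]) (use C X in auto)
  let ?b = "(card X - (card S + Suc d)) choose (k - (card S + Suc d))"
  have "{F\<in>\<C>. S \<subseteq> F} \<subseteq> (\<Union>z\<in>H0. {F\<in>\<C>. insert z S \<subseteq> F})" using meet[OF _ H0(1)] by fastforce
  then have "card {F\<in>\<C>. S \<subseteq> F} \<le> card (\<Union>z\<in>H0. {F\<in>\<C>. insert z S \<subseteq> F})"
    by (rule card_mono[rotated]) (use H[OF H0(1)] fC in auto)
  also have "\<dots> \<le> (\<Sum>z\<in>H0. card {F\<in>\<C>. insert z S \<subseteq> F})"
    using H[OF H0(1)] by (intro card_UN_le) auto
  also have "\<dots> \<le> (\<Sum>z\<in>H0. h ^ d * ?b)"
  proof (rule sum_mono)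
    fix z assume "z \<in> H0"
    then have "z \<notin> S" using H0(2) by blast
    then have c: "card (insert z S) = Suc (card S)" using Suc.prems(1) by simp
    have "card {F\<in>\<C>. insert z S \<subseteq> F}
        \<le> h ^ d * ((card X - (card (insert z S) + d)) choose (k - (card (insert z S) + d)))"
    proof (rule Suc.IH)
      show "finite (insert z S)" using Suc.prems(1) by simp
      show "\<exists>H\<in>\<H>. T \<inter> H = {}" if "insert z S \<subseteq> T" "finite T" "card T < card (insert z S) + d" for T
        using Suc.prems(2)[of T] that c by simp
    qed
    then show "card {F\<in>\<C>. insert z S \<subseteq> F} \<le> h ^ d * ?b" using c by simp
  qed
  also have "\<dots> = card H0 * (h ^ d * ?b)" by simp
  also have "\<dots> \<le> h * (h ^ d * ?b)" using H[OF H0(1)] by (intro mult_right_mono) auto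
  finally show ?case by (simp add: mult.assoc)
qed

text \<open>Fixing one more element shrinks the binomial by the factor \<open>N / K\<close>, which
  is at least \<open>c\<close>. With \<open>c = 4 * k\<close> this absorbs a branching factor
  \<open>k\<close> and still gains a factor 4.\<close>

lemma power_times_binomial_le:
  fixes c k n :: nat
  assumes "c * k \<le> n" "k \<le> n" "q + j \<le> k"
  shows "c ^ j * ((n - (q + j)) choose (k - (q + j))) \<le> (n - q) choose (k - q)"
  using assms(3)
proof (induction j)
  case (Suc j)
  let ?N = "n - (q + j)" and ?K = "k - (q + j)"
  have K: "?K > 0" using Suc.prems by simp
  have cK: "c * ?K \<le> ?N"
  proof (cases "c = 0")
    case False
    then have "q + j \<le> c * (q + j)" by simp
    moreover have "c * ?K = c * k - c * (q + j)" by (rule diff_mult_distrib2)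
    ultimately show ?thesis using assms(1) by linarith
  qed simp
  have "?K * (c * ((?N - 1) choose (?K - 1))) = (c * ?K) * ((?N - 1) choose (?K - 1))" by simp
  also have "\<dots> \<le> ?N * ((?N - 1) choose (?K - 1))" using cK by (intro mult_right_mono) auto
  also have "\<dots> = ?K * (?N choose ?K)" using K by (simp add: times_binomial_minus1_eq)
  finally have "c * ((?N - 1) choose (?K - 1)) \<le> ?N choose ?K" using K by simp
  then have "c ^ j * (c * ((?N - 1) choose (?K - 1))) \<le> c ^ j * (?N choose ?K)" by simp
  also have "\<dots> \<le> (n - q) choose (k - q)" using Suc by simp
  finally show ?case by (simp add: mult_ac)
qed simp

section \<open>Cover numbers\<close>

definition is_cover :: "'a set \<Rightarrow> 'a set set \<Rightarrow> bool" where
  "is_cover C \<A> \<longleftrightarrow> finite C \<and> (\<forall>F\<in>\<A>. C \<inter> F \<noteq> {})"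

text \<open>The transversal number. \<open>LEAST\<close> is unspecified when no finite cover exists,
  so \<open>cover_number_attained\<close> starts from a given cover.\<close>

definition cover_number :: "'a set set \<Rightarrow> nat" where
  "cover_number \<A> = (LEAST c. \<exists>C. is_cover C \<A> \<and> card C = c)"

lemma cover_number_le: "is_cover C \<A> \<Longrightarrow> cover_number \<A> \<le> card C"
  unfolding cover_number_def by (rule Least_le) auto

lemma cover_number_attained:
  assumes "is_cover C \<A>"
  obtains D where "is_cover D \<A>" "card D = cover_number \<A>"
proof -
  have "\<exists>D. is_cover D \<A> \<and> card D = cover_number \<A>"
    unfolding cover_number_def by (rule LeastI) (use assms in blast)
  then show ?thesis using that by blast
qed

lemma exists_disjoint_if_less_cover_number:
  assumes "finite T" "card T < cover_number \<A>"
  shows "\<exists>F\<in>\<A>. T \<inter> F = {}"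
  using assms cover_number_le[of T \<A>] by (auto simp: is_cover_def)

text \<open>Lets the powers of 4 gained by branching outweigh a product of two cover
  numbers.\<close>

lemma Suc_square_le_four_power: "Suc m * Suc m \<le> 4 ^ m"
proof (induction m)
  case (Suc m)
  have "Suc (Suc m) * Suc (Suc m) \<le> 4 * (Suc m * Suc m)" by simp
  also have "\<dots> \<le> 4 * 4 ^ m" using Suc by simp
  finally show ?case by simp
qed simp

section \<open>Intersecting \<open>k\<close>-sets and the sides of a pair of elements\<close>

text \<open>To be applied to the middle level with \<open>k = s + 1\<close>, where
  \<open>large\<close> reads \<open>4 * (s + 2)\<^sup>2 <= card X\<close>.\<close>

locale uniform_intersecting =
  fixes X :: "'a set" and \<A> :: "'a set set" and k :: nat
  assumes finX: "finite X"
    and unif: "\<And>F. F \<in> \<A> \<Longrightarrow> F \<subseteq> X \<and> card F = k"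
    and inter: "\<And>F F'. F \<in> \<A> \<Longrightarrow> F' \<in> \<A> \<Longrightarrow> F \<inter> F' \<noteq> {}"
    and large: "4 * (k + 1)\<^sup>2 \<le> card X"
begin

definition side :: "'a \<Rightarrow> 'a \<Rightarrow> 'a set set" where
  "side x a = {F\<in>\<A>. x \<in> F \<and> a \<notin> F}"

definition link :: "'a \<Rightarrow> 'a \<Rightarrow> 'a set set" where
  "link x a = (\<lambda>F. F - {x}) ` side x a"

text \<open>For \<open>k >= 3\<close>, the number of \<open>k\<close>-sets of \<open>X\<close>
  through three given elements.\<close>

abbreviation M :: nat where "M \<equiv> (card X - 3) choose (k - 3)"

lemma finA: "finite \<A>"
  by (rule finite_subset[of _ "Pow X"]) (use unif finX in auto)

lemma fin_member: "F \<in> \<A> \<Longrightarrow> finite F"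
  using unif finX finite_subset by blast

lemma large': "4 * k * k + k \<le> card X" "4 * k * k \<le> card X" "k \<le> card X" "3 < card X"
  using large by (auto simp: power2_eq_square algebra_simps)

text \<open>The two sides of a pair cross-intersect, and never in \<open>x\<close> or
  \<open>a\<close>, so each member of one side yields a cover of the opposite link.\<close>

lemma is_cover_link:
  assumes "F \<in> side a x"
  shows "is_cover (F - {a}) (link x a)" and "card (F - {a}) = k - 1" and "1 \<le> k"
proof -
  have F: "F \<in> \<A>" "a \<in> F" "x \<notin> F" using assms by (auto simp: side_def)
  show "is_cover (F - {a}) (link x a)"
    unfolding is_cover_def link_def side_def using F fin_member inter[OF F(1)] by fast
  show "card (F - {a}) = k - 1" using F fin_member unif by simp
  have "card F > 0" using F fin_member[of F] by (auto simp: card_gt_0_iff)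
  then show "1 \<le> k" using unif F by auto
qed

text \<open>A member of \<open>side x a\<close> contains, besides \<open>x\<close>, an element of
  \<open>C\<close>; this fixes the first two elements before branching starts.\<close>

lemma card_side_le_sum:
  assumes C: "is_cover C (link x a)"
    and le: "\<And>z. z \<noteq> x \<Longrightarrow> card {F\<in>side x a. {x, z} \<subseteq> F} \<le> b"
  shows "card (side x a) \<le> card C * b"
proof -
  have fC: "finite C" using C by (simp add: is_cover_def)
  have "side x a \<subseteq> (\<Union>z\<in>C - {x}. {F\<in>side x a. {x, z} \<subseteq> F})"
    using C by (fastforce simp: is_cover_def link_def side_def)
  then have "card (side x a) \<le> card (\<Union>z\<in>C - {x}. {F\<in>side x a. {x, z} \<subseteq> F})"
    by (rule card_mono[rotated]) (use fC finA in \<open>auto simp: side_def\<close>)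
  also have "\<dots> \<le> (\<Sum>z\<in>C - {x}. card {F\<in>side x a. {x, z} \<subseteq> F})"
    using fC by (intro card_UN_le) auto
  also have "\<dots> \<le> (\<Sum>z\<in>C - {x}. b)" by (rule sum_mono) (use le in auto)
  also have "\<dots> \<le> card C * b" using fC by (simp add: card_mono)
  finally show ?thesis .
qed

text \<open>Branches first over a minimum cover of \<open>link x a\<close>, then over members of \<open>link a x\<close>.\<close>

lemma side_bound_link:
  assumes "x \<noteq> a" and ne: "side x a \<noteq> {}" and q: "2 \<le> cover_number (link a x)"
  shows "4 ^ (cover_number (link a x) - 2) * card (side x a) \<le> cover_number (link x a) * k * M"
    and "cover_number (link a x) + 1 \<le> k"
proof -
  let ?q = "cover_number (link a x)"
  have "side a x \<noteq> {}"
  proof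
    assume "side a x = {}"
    then have "is_cover {} (link a x)" by (simp add: is_cover_def link_def)
    then show False using q cover_number_le by fastforce
  qed
  then obtain F' where "F' \<in> side a x" by auto
  then obtain C where C: "is_cover C (link x a)" "card C = cover_number (link x a)"
    using is_cover_link(1) cover_number_attained by metis
  obtain F where "F \<in> side x a" using ne by auto
  then have "?q \<le> k - 1" "1 \<le> k" using is_cover_link[of F x a] cover_number_le by fastforce+
  then show qk: "?q + 1 \<le> k" by simp
  let ?b = "(card X - (?q + 1)) choose (k - (?q + 1))"
  have "card {F\<in>side x a. {x, z} \<subseteq> F} \<le> k ^ (?q - 1) * ?b" if z: "z \<noteq> x" for z
  proof -
    have c: "card {x, z} + (?q - 1) = ?q + 1" using z q by simp
    have "card {F\<in>side x a. {x, z} \<subseteq> F}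
      \<le> k ^ (?q - 1) * ((card X - (card {x, z} + (?q - 1))) choose (k - (card {x, z} + (?q - 1))))"
    proof (rule card_containing_le_branching[OF finX, where \<H> = "link a x"])
      show "F \<subseteq> X \<and> card F = k" if "F \<in> side x a" for F using that unif by (auto simp: side_def)
      show "finite H \<and> card H \<le> k" if "H \<in> link a x" for H
        using that fin_member unif by (auto simp: link_def side_def intro: order.trans[OF card_Diff1_le])
      show "F \<inter> H \<noteq> {}" if "F \<in> side x a" "H \<in> link a x" for F H
        using that inter by (fastforce simp: link_def side_def)
      \<comment> \<open>No \<open>H\<close> in \<open>link a x\<close> contains \<open>x\<close>, so
        only \<open>T - {x}\<close> has to stay below the cover number. This yields one more round
        than counting all of \<open>T\<close>.\<close>
      show "\<exists>H\<in>link a x. T \<inter> H = {}"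
        if T: "{x, z} \<subseteq> T" "finite T" "card T < card {x, z} + (?q - 1)" for T
      proof -
        have "card (T - {x}) < card T" using T by (intro card_Diff1_less) auto
        then have "card (T - {x}) < ?q" using T(3) c by linarith
        then obtain H where "H \<in> link a x" "(T - {x}) \<inter> H = {}"
          using exists_disjoint_if_less_cover_number[of "T - {x}"] T by auto
        moreover have "x \<notin> H" using \<open>H \<in> link a x\<close> by (auto simp: link_def side_def)
        ultimately show ?thesis by auto
      qed
    qed simp
    then show ?thesis unfolding c .
  qed
  then have "card (side x a) \<le> card C * (k ^ (?q - 1) * ?b)" by (rule card_side_le_sum[OF C(1)])
  then have "4 ^ (?q - 2) * card (side x a) \<le> 4 ^ (?q - 2) * (card C * (k ^ (?q - 1) * ?b))" by simp
  \<comment> \<open>One factor \<open>k\<close> stays outside; the other \<open>?q - 2\<close>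
    rounds are absorbed in passing from fixed sets of size \<open>?q + 1\<close> to size 3.\<close>
  also have "\<dots> = card C * k * ((4 * k) ^ (?q - 2) * ?b)"
  proof -
    have "?q - 1 = Suc (?q - 2)" using q by simp
    then have "k ^ (?q - 1) = k * k ^ (?q - 2)" by simp
    then show ?thesis by (simp only: power_mult_distrib mult_ac)
  qed
  also have "\<dots> \<le> card C * k * M"
    using power_times_binomial_le[of "4 * k" k "card X" 3 "?q - 2"] large' q qk
    by (intro mult_left_mono) auto
  finally show "4 ^ (?q - 2) * card (side x a) \<le> cover_number (link x a) * k * M" using C by simp
qed

text \<open>Here the branching uses all members of \<open>\<A>\<close>, so the gain depends on
  \<open>cover_number \<A>\<close> alone and persists when the links have small covers.\<close>

lemma side_bound_cover_number:
  assumes "x \<noteq> a" and ne: "side a x \<noteq> {}" and r: "3 \<le> cover_number \<A>"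
  shows "4 ^ (cover_number \<A> - 3) * card (side x a) \<le> cover_number (link x a) * k * M"
proof -
  let ?r = "cover_number \<A>"
  obtain F' where F': "F' \<in> side a x" using ne by auto
  then obtain C where C: "is_cover C (link x a)" "card C = cover_number (link x a)"
    using is_cover_link(1) cover_number_attained by metis
  have "is_cover F' \<A>" using F' inter fin_member by (auto simp: is_cover_def side_def)
  then have rk: "?r \<le> k" using cover_number_le unif F' by (fastforce simp: side_def)
  let ?b = "(card X - ?r) choose (k - ?r)"
  have "card {F\<in>side x a. {x, z} \<subseteq> F} \<le> k ^ (?r - 2) * ?b" if z: "z \<noteq> x" for z
  proof -
    have c: "card {x, z} + (?r - 2) = ?r" using z r by simp
    have "card {F\<in>side x a. {x, z} \<subseteq> F}
      \<le> k ^ (?r - 2) * ((card X - (card {x, z} + (?r - 2))) choose (k - (card {x, z} + (?r - 2))))"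
    proof (rule card_containing_le_branching[OF finX, where \<H> = \<A>])
      show "\<exists>H\<in>\<A>. T \<inter> H = {}" if T: "finite T" "card T < card {x, z} + (?r - 2)" for T
        using exists_disjoint_if_less_cover_number[of T \<A>] T c by simp
    qed (use unif fin_member inter in \<open>auto simp: side_def\<close>)
    then show ?thesis unfolding c .
  qed
  then have "card (side x a) \<le> card C * (k ^ (?r - 2) * ?b)" by (rule card_side_le_sum[OF C(1)])
  then have "4 ^ (?r - 3) * card (side x a) \<le> 4 ^ (?r - 3) * (card C * (k ^ (?r - 2) * ?b))" by simp
  also have "\<dots> = card C * k * ((4 * k) ^ (?r - 3) * ?b)"
  proof -
    have "?r - 2 = Suc (?r - 3)" using r by simp
    then have "k ^ (?r - 2) = k * k ^ (?r - 3)" by simp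
    then show ?thesis by (simp only: power_mult_distrib mult_ac)
  qed
  also have "\<dots> \<le> card C * k * M"
    using power_times_binomial_le[of "4 * k" k "card X" 3 "?r - 3"] large' r rk
    by (intro mult_left_mono) auto
  finally show ?thesis using C by simp
qed

text \<open>Write \<open>r\<close>, \<open>p\<close>, \<open>q\<close> for the cover numbers of
  \<open>\<A>\<close>, \<open>link x a\<close>, \<open>link a x\<close>. The bound by
  \<open>r\<close> gives \<open>4 ^ (r - 2) < (r - 1) * p\<close>, which with \<open>p <= q\<close>
  forces \<open>q >= r\<close>. Then the bound by \<open>q\<close> gives
  \<open>4 ^ (q - 1) < (r - 1) * p <= q * q\<close>, too small.\<close>

lemma not_both_sides_large_aux:
  assumes xa: "x \<noteq> a" and r: "3 \<le> cover_number \<A>"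
    and P: "4 * k * M < (cover_number \<A> - 1) * card (side x a)"
    and Q: "4 * k * M < (cover_number \<A> - 1) * card (side a x)"
    and le: "cover_number (link x a) \<le> cover_number (link a x)"
  shows False
proof -
  let ?r = "cover_number \<A>" and ?p = "cover_number (link x a)" and ?q = "cover_number (link a x)"
  let ?P = "card (side x a)"
  have ne: "side x a \<noteq> {}" "side a x \<noteq> {}" using P Q by auto
  have *: "4 ^ Suc e < (?r - 1) * ?p" if "4 ^ e * ?P \<le> ?p * k * M" for e
  proof -
    have "4 ^ Suc e * (k * M) = 4 ^ e * (4 * k * M)" by simp
    also have "\<dots> < 4 ^ e * ((?r - 1) * ?P)" using P by simp
    also have "\<dots> = (?r - 1) * (4 ^ e * ?P)" by simp
    also have "\<dots> \<le> (?r - 1) * (?p * k * M)" using that by (rule mult_left_mono) simp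
    finally have "4 ^ Suc e * (k * M) < ((?r - 1) * ?p) * (k * M)" by (simp add: mult_ac)
    then show ?thesis by (simp only: mult_less_cancel2)
  qed
  have "4 ^ Suc (?r - 3) < (?r - 1) * ?p" using *[OF side_bound_cover_number[OF xa ne(2) r]] .
  also have "\<dots> \<le> (?r - 1) * ?q" using le by simp
  also have "Suc (?r - 3) = ?r - 2" using r by simp
  finally have 1: "4 ^ (?r - 2) < (?r - 1) * ?q" .
  have "?r \<le> ?q"
  proof (rule ccontr)
    assume "\<not> ?r \<le> ?q"
    then have "(?r - 1) * ?q \<le> (?r - 1) * (?r - 1)" by (intro mult_left_mono) auto
    also have "\<dots> \<le> 4 ^ (?r - 2)" using Suc_square_le_four_power[of "?r - 2"] r
      by (simp add: Suc_diff_Suc numeral_2_eq_2)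
    finally show False using 1 by simp
  qed
  then have q: "3 \<le> ?q" "2 \<le> ?q" using r by auto
  have "4 ^ Suc (?q - 2) < (?r - 1) * ?p" using *[OF side_bound_link(1)[OF xa ne(1) q(2)]] .
  also have "\<dots> \<le> ?q * ?q" using le \<open>?r \<le> ?q\<close> by (intro mult_mono) auto
  also have "\<dots> \<le> 4 ^ (?q - 1)" using Suc_square_le_four_power[of "?q - 1"] q by simp
  also have "?q - 1 = Suc (?q - 2)" using q by simp
  finally show False by simp
qed

lemma not_both_sides_large:
  assumes "x \<noteq> a" "3 \<le> cover_number \<A>"
    and "4 * k * M < (cover_number \<A> - 1) * card (side x a)"
    and "4 * k * M < (cover_number \<A> - 1) * card (side a x)"
  shows False
  using not_both_sides_large_aux[of x a] not_both_sides_large_aux[of a x] assms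
  by (metis nat_le_linear)

section \<open>Elements at which averaging succeeds\<close>

text \<open>The sum is that of \<open>pair_degree i x\<close> over all \<open>i\<close> outside \<open>Y\<close> and different from \<open>x\<close>.\<close>

definition good_pivot :: "'a \<Rightarrow> 'a set \<Rightarrow> bool" where
  "good_pivot x Y \<longleftrightarrow> x \<in> X \<and> Y \<subseteq> X - {x} \<and> card Y \<le> 2 \<and>
     (\<Sum>F | F \<in> \<A> \<and> x \<notin> F. card (F - Y)) \<le> (card X - 1 - card Y) * binom (card X - 4) (int k - 3)"

text \<open>Absorption turns \<open>(card X - k) * M\<close> into \<open>(card X - 3)\<close> times
  the smaller binomial, and \<open>large\<close> gives
  \<open>4 * k * k <= card X - k\<close>.\<close>

lemma four_k_square_M_le:
  assumes "3 \<le> k"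
  shows "4 * k * k * M \<le> (card X - 1) * binom (card X - 4) (int k - 3)"
proof -
  have b: "binom (card X - 4) (int k - 3) = (card X - 3 - 1) choose (k - 3)"
    using assms by (simp add: binom_def nat_diff_distrib)
  have "4 * k * k * M \<le> ((card X - 3) - (k - 3)) * M"
    using large' assms by (intro mult_right_mono) auto
  also have "\<dots> = (card X - 3) * ((card X - 3 - 1) choose (k - 3))" by (rule binomial_absorb_comp)
  also have "\<dots> \<le> (card X - 1) * ((card X - 3 - 1) choose (k - 3))" by (intro mult_right_mono) auto
  finally show ?thesis using b by simp
qed

text \<open>The source of the threshold \<open>4 * k * M\<close>: every member avoiding
  \<open>x\<close> has weight \<open>k\<close>.\<close>

lemma good_pivot_empty:
  assumes "x \<in> X" "3 \<le> k" "card {F\<in>\<A>. x \<notin> F} \<le> 4 * k * M"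
  shows "good_pivot x {}"
proof -
  have "(\<Sum>F | F \<in> \<A> \<and> x \<notin> F. card F) = k * card {F\<in>\<A>. x \<notin> F}"
    using unif by simp
  also have "\<dots> \<le> k * (4 * k * M)" using assms by simp
  also have "\<dots> \<le> (card X - 1) * binom (card X - 4) (int k - 3)"
    using four_k_square_M_le assms by (simp add: mult_ac)
  finally show ?thesis using assms by (simp add: good_pivot_def)
qed

text \<open>All members avoiding \<open>x\<close> contain \<open>y\<close> and a common further
  element \<open>z\<close>. These two elements have the full degree among such members, so
  \<open>Y = {y, z}\<close> removes them from the average.\<close>

lemma good_pivot_if_link_star:
  assumes C: "is_cover {x, y} \<A>" and xy: "x \<noteq> y" and x: "x \<in> X" and ne: "side y x \<noteq> {}"
    and star: "cover_number (link y x) \<le> 1" "side x y \<noteq> {}"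
  shows "\<exists>Y. good_pivot x Y"
proof -
  obtain F' where "F' \<in> side x y" using star by auto
  then obtain Z where Z: "is_cover Z (link y x)" "card Z \<le> 1"
    using is_cover_link(1) cover_number_attained star by metis
  have D: "{F. F \<in> \<A> \<and> x \<notin> F} = side y x"
    using C by (auto simp: is_cover_def side_def)
  obtain F0 where F0: "F0 \<in> side y x" using ne by auto
  have "Z \<inter> (F0 - {y}) \<noteq> {}" using Z F0 by (auto simp: is_cover_def link_def)
  then obtain z where z: "z \<in> Z" "z \<in> F0" "z \<noteq> y" by auto
  then have Zz: "Z = {z}" using Z by (auto simp: is_cover_def card_le_Suc0_iff_eq)
  have zx: "z \<noteq> x" "z \<in> X" "y \<in> X" using z F0 unif by (auto simp: side_def)
  have sub: "side y x \<subseteq> {F. {y, z} \<subseteq> F \<and> F \<subseteq> X - {x} \<and> card F = k}"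
    using Z unif by (fastforce simp: is_cover_def link_def side_def Zz)
  then have k: "2 \<le> k"
  proof -
    have "card {y, z} \<le> card F0" using F0 sub fin_member by (intro card_mono) (auto simp: side_def)
    then show ?thesis using F0 sub z by auto
  qed
  have "card {F. {y, z} \<subseteq> F \<and> F \<subseteq> X - {x} \<and> card F = k} = (card X - 3) choose (k - 2)"
    using card_sets_between[of "X - {x}" "{y, z}" k] finX x zx z xy k by (simp add: numeral_3_eq_3 numeral_2_eq_2)
  then have cs: "card (side y x) \<le> (card X - 3) choose (k - 2)"
    using card_mono[OF _ sub] finX by (simp add: finite_subset[of _ "Pow (X - {x})"] subset_eq)
  have "(\<Sum>F\<in>side y x. card (F - {y, z})) = (\<Sum>F\<in>side y x. k - 2)"
  proof (rule sum.cong[OF refl])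
    fix F assume "F \<in> side y x"
    then have "{y, z} \<subseteq> F" "card F = k" using sub by auto
    then show "card (F - {y, z}) = k - 2" using z by (simp add: card_Diff_subset)
  qed
  also have "\<dots> \<le> (k - 2) * ((card X - 3) choose (k - 2))" using cs by simp
  \<comment> \<open>For \<open>k > 2\<close> this is an absorption identity, hence without loss; for
    \<open>k = 2\<close> no weight is left outside \<open>{y, z}\<close>.\<close>
  also have "\<dots> \<le> (card X - 3) * binom (card X - 4) (int k - 3)"
  proof (cases "k = 2")
    case False
    then have "(k - 2) * ((card X - 3) choose (k - 2)) = (card X - 3) * ((card X - 3 - 1) choose (k - 2 - 1))"
      using k by (intro times_binomial_minus1_eq) auto
    then show ?thesis using k False by (simp add: binom_def nat_diff_distrib)
  qed simp
  finally have "good_pivot x {y, z}" using x xy zx z D by (simp add: good_pivot_def numeral_3_eq_3)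
  then show ?thesis ..
qed

text \<open>The members avoiding \<open>y\<close> form \<open>side x y\<close>. With
  \<open>p <= q\<close> for the cover numbers of the two links,
  \<open>p <= q * q <= 4 * 4 ^ (q - 2)\<close>, so \<open>side_bound_link\<close> brings that side
  below the threshold.\<close>

lemma good_pivot_if_cover_number_two:
  assumes C: "is_cover {x, y} \<A>" and xy: "x \<noteq> y" and X: "x \<in> X" "y \<in> X"
    and ne: "side x y \<noteq> {}" "side y x \<noteq> {}"
    and le: "cover_number (link x y) \<le> cover_number (link y x)"
    and q: "2 \<le> cover_number (link y x)"
  shows "good_pivot y {}"
proof -
  let ?p = "cover_number (link x y)" and ?q = "cover_number (link y x)"
  have D: "{F\<in>\<A>. y \<notin> F} = side x y" using C by (auto simp: is_cover_def side_def)
  have k: "3 \<le> k" using side_bound_link(2)[OF xy ne(1) q] q by simp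
  have "?p \<le> 4 * 4 ^ (?q - 2)"
  proof -
    have "?q \<le> ?q * ?q" by simp
    also have "\<dots> \<le> 4 ^ (?q - 1)" using Suc_square_le_four_power[of "?q - 1"] q by simp
    also have "?q - 1 = Suc (?q - 2)" using q by simp
    finally show ?thesis using le by simp
  qed
  then have "?p * (k * M) \<le> 4 * 4 ^ (?q - 2) * (k * M)" by (rule mult_right_mono) simp
  moreover have "4 ^ (?q - 2) * card (side x y) \<le> ?p * (k * M)"
    using side_bound_link(1)[OF xy ne(1) q] by (simp only: mult.assoc)
  ultimately have "4 ^ (?q - 2) * card (side x y) \<le> 4 * 4 ^ (?q - 2) * (k * M)" by linarith
  also have "\<dots> = 4 ^ (?q - 2) * (4 * k * M)" by (simp only: mult_ac)
  finally have "card (side x y) \<le> 4 * k * M" by simp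
  then show ?thesis using good_pivot_empty[OF X(2) k] D by simp
qed

text \<open>Take \<open>x\<close> of maximum degree in a minimum cover \<open>R\<close>. If too many
  members avoid \<open>x\<close>, one of the other \<open>r - 1\<close> elements \<open>a\<close> of
  \<open>R\<close> has a large \<open>side a x\<close>; by maximality \<open>side x a\<close> is at
  least as large, contradicting \<open>not_both_sides_large\<close>.\<close>

lemma good_pivot_if_cover_number_three:
  assumes r: "3 \<le> cover_number \<A>"
  shows "\<exists>x. good_pivot x {}"
proof (rule ccontr)
  assume no: "\<not> ?thesis"
  let ?r = "cover_number \<A>" and ?deg = "\<lambda>x. card {F\<in>\<A>. x \<in> F}"
  have "\<A> \<noteq> {}"
  proof
    assume "\<A> = {}"
    then have "is_cover {} \<A>" by (simp add: is_cover_def)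
    then show False using r cover_number_le by fastforce
  qed
  then obtain F0 where F0: "F0 \<in> \<A>" by auto
  then have cov: "is_cover F0 \<A>" using inter fin_member by (auto simp: is_cover_def)
  then have k: "3 \<le> k" using r cover_number_le unif[OF F0] by fastforce
  obtain R where R: "is_cover R \<A>" "card R = ?r" using cover_number_attained[OF cov] by auto
  then have fR: "finite R" "R \<noteq> {}" using r by (auto simp: is_cover_def)
  then obtain x where x: "x \<in> R" "\<And>a. a \<in> R \<Longrightarrow> ?deg a \<le> ?deg x"
    using finite_imageI[OF fR(1), of ?deg] Max_in[of "?deg ` R"] Max_ge[of "?deg ` R"]
    by (smt (verit, ccfv_threshold) image_iff image_is_empty)
  \<comment> \<open>Minimality of \<open>R\<close> gives a member met only in \<open>x\<close>,
    which places \<open>x\<close> in \<open>X\<close>.\<close>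
  have "\<exists>F\<in>\<A>. (R - {x}) \<inter> F = {}"
    by (rule exists_disjoint_if_less_cover_number) (use fR R x r in auto)
  then have "x \<in> X" using R unif by (fastforce simp: is_cover_def)
  then have big: "4 * k * M < card {F\<in>\<A>. x \<notin> F}" using no good_pivot_empty[OF _ k, of x] by force
  have "\<exists>a\<in>R - {x}. 4 * k * M < (?r - 1) * card (side a x)"
  proof (rule ccontr)
    assume "\<not> ?thesis"
    then have small: "(?r - 1) * card (side a x) \<le> 4 * k * M" if "a \<in> R - {x}" for a
      using that by force
    have "{F\<in>\<A>. x \<notin> F} \<subseteq> (\<Union>a\<in>R - {x}. side a x)"
      using R by (fastforce simp: is_cover_def side_def)
    then have "card {F\<in>\<A>. x \<notin> F} \<le> card (\<Union>a\<in>R - {x}. side a x)"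
      by (rule card_mono[rotated]) (use fR finA in \<open>auto simp: side_def\<close>)
    also have "\<dots> \<le> (\<Sum>a\<in>R - {x}. card (side a x))" using fR by (intro card_UN_le) auto
    finally have "(?r - 1) * card {F\<in>\<A>. x \<notin> F} \<le> (\<Sum>a\<in>R - {x}. (?r - 1) * card (side a x))"
      by (simp flip: sum_distrib_left)
    also have "\<dots> \<le> (\<Sum>a\<in>R - {x}. 4 * k * M)" by (rule sum_mono) (use small in auto)
    also have "\<dots> = (?r - 1) * (4 * k * M)" using fR x R by simp
    finally show False using big r by simp
  qed
  then obtain a where a: "a \<in> R" "a \<noteq> x" "4 * k * M < (?r - 1) * card (side a x)" by auto
  have deg: "?deg u = card (side u v) + card {F\<in>\<A>. u \<in> F \<and> v \<in> F}" for u v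
  proof -
    have "{F\<in>\<A>. u \<in> F} = side u v \<union> {F\<in>\<A>. u \<in> F \<and> v \<in> F}" by (auto simp: side_def)
    then show ?thesis using finA
      by (simp, subst card_Un_disjoint[symmetric]) (auto simp: side_def)
  qed
  have "card (side a x) \<le> card (side x a)"
    using deg[of x a] deg[of a x] x(2)[OF a(1)] by (simp add: conj_commute)
  then have "(?r - 1) * card (side a x) \<le> (?r - 1) * card (side x a)" by simp
  then have "4 * k * M < (?r - 1) * card (side x a)" using a(3) by linarith
  then show False using not_both_sides_large a r by blast
qed

lemma exists_good_pivot: "\<exists>x Y. good_pivot x Y"
proof (cases "\<A> = {}")
  case True
  have "X \<noteq> {}" using large' by auto
  then obtain x where "x \<in> X" by auto
  then have "good_pivot x {}" unfolding good_pivot_def using True by simp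
  then show ?thesis by blast
next
  case False
  then obtain F0 where F0: "F0 \<in> \<A>" by auto
  then have cov: "is_cover F0 \<A>" using inter fin_member by (auto simp: is_cover_def)
  obtain R where R: "is_cover R \<A>" "card R = cover_number \<A>" using cover_number_attained[OF cov] by auto
  then have fR: "finite R" by (simp add: is_cover_def)
  have RX: "R \<subseteq> X"
  proof
    fix x assume x: "x \<in> R"
    have "card (R - {x}) < cover_number \<A>" using card_Diff1_less[OF fR x] R(2) by simp
    then have "\<exists>F\<in>\<A>. (R - {x}) \<inter> F = {}"
      using fR by (intro exists_disjoint_if_less_cover_number) auto
    then show "x \<in> X" using R unif by (fastforce simp: is_cover_def)
  qed
  consider "card R = 0" | "card R = 1" | "card R = 2" | "3 \<le> card R" by linarith
  then show ?thesis
  proof cases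
    case 1
    then show ?thesis using fR R F0 by (auto simp: is_cover_def)
  next
    case 2
    then obtain x where "R = {x}" by (rule card_1_singletonE)
    then have "{F. F \<in> \<A> \<and> x \<notin> F} = {}" "x \<in> X" using R(1) RX by (auto simp: is_cover_def)
    then have "good_pivot x {}" by (simp add: good_pivot_def del: Collect_empty_eq)
    then show ?thesis by blast
  next
    case 3
    then obtain x y where xy: "R = {x, y}" "x \<noteq> y" by (auto simp: card_2_iff)
    then have C: "is_cover {x, y} \<A>" "is_cover {y, x} \<A>" using R by (auto simp: insert_commute)
    have ne: "side u v \<noteq> {}" if "{u, v} = {x, y}" for u v
    proof -
      have "\<exists>F\<in>\<A>. {v} \<inter> F = {}"
        by (rule exists_disjoint_if_less_cover_number) (use 3 R in auto)
      then show ?thesis using C that by (auto simp: side_def is_cover_def doubleton_eq_iff)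
    qed
    have ne: "side x y \<noteq> {}" "side y x \<noteq> {}" using ne by auto
    have X: "x \<in> X" "y \<in> X" using xy RX by auto
    consider "cover_number (link y x) \<le> 1" | "cover_number (link x y) \<le> 1"
      | "2 \<le> cover_number (link y x)" "2 \<le> cover_number (link x y)" by linarith
    then show ?thesis
    proof cases
      case 1
      then show ?thesis using good_pivot_if_link_star[OF C(1) xy(2) X(1) ne(2) 1 ne(1)] by blast
    next
      case 2
      then show ?thesis using good_pivot_if_link_star[OF C(2) _ X(2) ne(1) 2 ne(2)] xy by blast
    next
      case 3
      then show ?thesis
        using good_pivot_if_cover_number_two[OF C(1) xy(2) X ne]
          good_pivot_if_cover_number_two[OF C(2) xy(2)[symmetric] X(2,1) ne(2,1)]
        by (cases "cover_number (link x y) \<le> cover_number (link y x)") auto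
    qed
  next
    case 4
    then show ?thesis using good_pivot_if_cover_number_three R by auto
  qed
qed

end

section \<open>Bounds for the sturdiness\<close>

text \<open>Averages \<open>pair_degree \<G> i x\<close> over the set \<open>I\<close> belonging to
  a good pivot, each \<open>G\<close> having weight \<open>card (G - Y)\<close>. The pivot controls
  the middle level; the other levels are paired inside \<open>X - {x}\<close>.\<close>

lemma exists_pair_degree_le_odd:
  fixes \<G> :: "nat set set"
  assumes X: "finite X" and sub: "\<G> \<subseteq> Pow X"
    and un: "\<And>G G'. G \<in> \<G> \<Longrightarrow> G' \<in> \<G> \<Longrightarrow> card (G \<union> G') \<le> 2 * s + 1"
    and n: "4 * (s + 2)\<^sup>2 \<le> card X" "36 * (s + 7) \<le> card X"
  shows "\<exists>i\<in>X. \<exists>x\<in>X. i \<noteq> x \<and>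
    pair_degree \<G> i x \<le> binom (card X - 4) (int s - 2) + (\<Sum>j<s. (card X - 2) choose j)"
proof -
  have finG: "finite \<G>" using X sub finite_subset by blast
  have fing: "finite G" if "G \<in> \<G>" for G using that X sub finite_subset by blast
  interpret U: uniform_intersecting X "{G\<in>\<G>. card G = s + 1}" "s + 1"
  proof
    show "F \<inter> F' \<noteq> {}" if "F \<in> {G\<in>\<G>. card G = s + 1}" "F' \<in> {G\<in>\<G>. card G = s + 1}" for F F'
    proof
      assume "F \<inter> F' = {}"
      then have "card (F \<union> F') = 2 * s + 2" using that fing by (simp add: card_Un_disjoint)
      then show False using un[of F F'] that by simp
    qed
    have "s + 1 + 1 = s + 2" by simp
    then show "4 * (s + 1 + 1)\<^sup>2 \<le> card X" using n(1) by (simp only:)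
  qed (use X sub in auto)
  obtain x Y where xY: "U.good_pivot x Y" using U.exists_good_pivot by blast
  then have x: "x \<in> X" and Y: "Y \<subseteq> X - {x}" "card Y \<le> 2"
    and mid: "(\<Sum>G | G \<in> \<G> \<and> card G = s + 1 \<and> x \<notin> G. card (G - Y))
      \<le> (card X - 1 - card Y) * binom (card X - 4) (int s - 2)"
    unfolding U.good_pivot_def by (simp_all add: conj_assoc)
  have finY: "finite Y" using Y X finite_subset by blast
  define I where "I = X - {x} - Y"
  have finI: "finite I" using X by (simp add: I_def)
  have cI: "card I = card X - 1 - card Y"
    using X x Y finY unfolding I_def by (simp add: card_Diff_subset)
  have GI: "card (G \<inter> I) = card (G - Y)" if "G \<subseteq> X" "x \<notin> G" for G
    using that by (intro arg_cong[where f = card]) (auto simp: I_def)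
  let ?wt = "\<lambda>G. card (G - Y)" and ?H = "{G\<in>\<G>. x \<notin> G}"
  let ?b = "\<Sum>j<s. (card X - 2) choose j"
  have cX: "card (X - {x}) = card X - 1" using X x by simp
  have "(\<Sum>G | G \<in> ?H \<and> 2 * card G \<noteq> (2 * s + 1) + 1. ?wt G)
      \<le> (\<Sum>D | D \<subseteq> X - {x} \<and> 2 * card D \<le> 2 * s + 1. ?wt D)"
  proof (rule sum_pairing_levels)
    fix m l assume ml: "l < m" "1 \<le> l" "m + l = 2 * s + 1 + 1"
    let ?Gm = "{G. G \<in> ?H \<and> card G = m}"
    let ?miss = "{D. D \<subseteq> X - {x} \<and> card D = l \<and> (\<exists>G\<in>?Gm. D \<inter> G = {})}"
    have eq: "{D. D \<subseteq> X - {x} \<and> card D = l \<and> (\<exists>G\<in>?H. card G = m \<and> D \<inter> G = {})} = ?miss"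
      by auto
    have finm: "finite ?miss" by (rule finite_subset[of _ "Pow X"]) (use X in auto)
    have shadow: "(card X - 1 - m) * card ?Gm \<le> l * card ?miss"
      unfolding cX[symmetric]
    proof (rule card_le_card_disjoint_sets)
      show "card (G \<union> G') < m + l" if "G \<in> ?Gm" "G' \<in> ?Gm" for G G'
        using un[of G G'] that ml by simp
    qed (use X sub ml n cX in auto)
    have up: "sum ?wt ?Gm \<le> m * card ?Gm"
    proof -
      have "?wt G \<le> m" if "G \<in> ?Gm" for G
        using that fing by (auto intro: card_mono)
      then have "sum ?wt ?Gm \<le> of_nat (card ?Gm) * m" by (rule sum_bounded_above)
      then show ?thesis by (simp add: mult.commute)
    qed
    \<comment> \<open>As \<open>Y\<close> has at most two elements, \<open>l\<close> is at most
      three times the weight of \<open>D\<close> unless \<open>D\<close> lies in \<open>Y\<close>.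
      At most four such exceptions, each losing at most 2, make the error 8.\<close>
    have low: "l * card ?miss \<le> 3 * sum ?wt ?miss + 8"
    proof -
      have "l \<le> 3 * ?wt D + (if D \<in> Pow Y then 2 else 0)" if D: "D \<in> ?miss" for D
      proof -
        have "finite D" using D X finite_subset by auto
        then have "card D \<le> ?wt D + card Y" using diff_card_le_card_Diff[OF finY, of D] by linarith
        moreover have "D \<in> Pow Y" if "?wt D = 0" using that \<open>finite D\<close> by auto
        ultimately show ?thesis using D Y by (cases "?wt D = 0") auto
      qed
      then have "(\<Sum>D\<in>?miss. l) \<le> (\<Sum>D\<in>?miss. 3 * ?wt D + (if D \<in> Pow Y then 2 else 0))"
        by (rule sum_mono)
      also have "\<dots> = 3 * sum ?wt ?miss + 2 * card (?miss \<inter> Pow Y)"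
        using finm by (simp add: sum.distrib sum_distrib_left sum.If_cases Int_def)
      also have "card (?miss \<inter> Pow Y) \<le> card (Pow Y)" by (rule card_mono) (use finY in auto)
      also have "card (Pow Y) \<le> 2 ^ 2" unfolding card_Pow[OF finY] by (rule power_increasing) (use Y in auto)
      finally show ?thesis by (simp add: mult.commute)
    qed
    have "sum ?wt ?Gm \<le> sum ?wt ?miss"
    proof (cases "?Gm = {}")
      case False
      then have "1 \<le> card ?Gm" using finG by (simp add: Suc_le_eq card_gt_0_iff)
      \<comment> \<open>Holds since \<open>m <= 2 * s + 1\<close>. The slack of 8 per member pays
        for the error in \<open>low\<close>, because \<open>?Gm\<close> is nonempty.\<close>
      have "3 * m + 8 \<le> card X - 1 - m" using ml n(2) by simp
      then have "(3 * m + 8) * card ?Gm \<le> (card X - 1 - m) * card ?Gm" by (rule mult_right_mono) simp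
      then have "3 * (m * card ?Gm) + 8 * card ?Gm \<le> 3 * sum ?wt ?miss + 8"
        using shadow low by (simp add: add_mult_distrib)
      then have "m * card ?Gm \<le> sum ?wt ?miss" using \<open>1 \<le> card ?Gm\<close> by linarith
      then show ?thesis using up by linarith
    qed (simp del: Collect_empty_eq)
    then show "sum ?wt ?Gm \<le> (\<Sum>D | D \<subseteq> X - {x} \<and> card D = l \<and>
        (\<exists>G\<in>?H. card G = m \<and> D \<inter> G = {}). ?wt D)"
      unfolding eq .
  qed (use X sub un in auto)
  also have "\<dots> = (\<Sum>D | D \<in> {D. D \<subseteq> X \<and> card D \<le> s} \<and> x \<notin> D. card (D \<inter> I))"
    by (rule sum.cong) (auto simp: GI)
  also have "\<dots> = (\<Sum>i\<in>I. pair_degree {D. D \<subseteq> X \<and> card D \<le> s} i x)"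
    using X by (subst sum_pair_degree_fixed) (auto simp: finI I_def)
  also have "\<dots> = (\<Sum>i\<in>I. ?b)"
    by (rule sum.cong) (auto simp: I_def X x pair_degree_bounded_sets)
  also have "\<dots> = card I * ?b" by simp
  finally have rest: "(\<Sum>G | G \<in> ?H \<and> 2 * card G \<noteq> 2 * s + 1 + 1. ?wt G) \<le> card I * ?b" .
  have "(\<Sum>i\<in>I. pair_degree \<G> i x) = (\<Sum>G\<in>?H. card (G \<inter> I))"
    by (rule sum_pair_degree_fixed) (use X finG in \<open>auto simp: I_def\<close>)
  also have "\<dots> = (\<Sum>G\<in>?H. ?wt G)" by (rule sum.cong) (use sub GI in auto)
  also have "?H = {G. G \<in> ?H \<and> 2 * card G \<noteq> 2 * s + 1 + 1} \<union> {G. G \<in> \<G> \<and> card G = s + 1 \<and> x \<notin> G}"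
    by auto
  also have "sum ?wt \<dots> = (\<Sum>G | G \<in> ?H \<and> 2 * card G \<noteq> 2 * s + 1 + 1. ?wt G)
      + (\<Sum>G | G \<in> \<G> \<and> card G = s + 1 \<and> x \<notin> G. ?wt G)"
    by (rule sum.union_disjoint) (use finG in auto)
  also have "\<dots> \<le> card I * ?b + card I * binom (card X - 4) (int s - 2)"
    using rest mid unfolding cI by (rule add_mono)
  finally have total: "(\<Sum>i\<in>I. pair_degree \<G> i x) \<le> card I * (binom (card X - 4) (int s - 2) + ?b)"
    by (simp add: algebra_simps)
  have "\<exists>i\<in>I. pair_degree \<G> i x \<le> binom (card X - 4) (int s - 2) + ?b"
  proof (rule ccontr)
    assume "\<not> ?thesis"
    then have "binom (card X - 4) (int s - 2) + ?b < pair_degree \<G> i x" if "i \<in> I" for i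
      using that by force
    moreover have "I \<noteq> {}" using cI n(2) Y by auto
    ultimately have "(\<Sum>i\<in>I. binom (card X - 4) (int s - 2) + ?b) < (\<Sum>i\<in>I. pair_degree \<G> i x)"
      using finI by (intro sum_strict_mono) auto
    then show False using total by simp
  qed
  then show ?thesis using x by (auto simp: I_def)
qed

section \<open>Complements and the sturdiness\<close>

lemma sturdiness_le:
  assumes "i \<in> {1..n}" "j \<in> {1..n}" "i \<noteq> j"
  shows "sturdiness n \<F> \<le> pair_degree \<F> i j"
  unfolding sturdiness_def
proof (rule Min_le)
  show "finite {pair_degree \<F> i j |i j. i \<in> {1..n} \<and> j \<in> {1..n} \<and> i \<noteq> j}"
    by (rule finite_subset[of _ "(\<lambda>(i, j). pair_degree \<F> i j) ` ({1..n} \<times> {1..n})"]) auto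
qed (use assms in auto)

lemma pair_degree_complements:
  assumes "\<F> \<subseteq> Pow X" "i \<in> X" "j \<in> X"
  shows "pair_degree ((\<lambda>F. X - F) ` \<F>) i j = pair_degree \<F> j i"
proof -
  have "{G \<in> (\<lambda>F. X - F) ` \<F>. i \<in> G \<and> j \<notin> G} = (\<lambda>F. X - F) ` {F \<in> \<F>. j \<in> F \<and> i \<notin> F}"
    using assms by auto
  moreover have "inj_on (\<lambda>F. X - F) {F \<in> \<F>. j \<in> F \<and> i \<notin> F}"
    using assms by (intro inj_onI) blast
  ultimately show ?thesis by (simp add: pair_degree_def card_image)
qed

lemma card_union_complements:
  assumes "t_intersecting t \<F>" "\<F> \<subseteq> Pow X" "finite X"
    and "G \<in> (\<lambda>F. X - F) ` \<F>" "G' \<in> (\<lambda>F. X - F) ` \<F>"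
  shows "card (G \<union> G') \<le> card X - t"
proof -
  obtain F F' where F: "F \<in> \<F>" "F' \<in> \<F>" "G = X - F" "G' = X - F'" using assms by auto
  then have "G \<union> G' = X - (F \<inter> F')" by auto
  moreover have "t \<le> card (F \<inter> F')" using assms F by (simp add: t_intersecting_def)
  moreover have "F \<inter> F' \<subseteq> X" "finite (F \<inter> F')" using F assms by (auto intro: finite_subset)
  ultimately show ?thesis by (simp add: card_Diff_subset)
qed

lemma sum_binom_eq: "(\<Sum>j\<in>{0..int s - 1}. binom m j) = (\<Sum>j<s. m choose j)"
  by (rule sum.reindex_bij_witness[where i = int and j = nat]) (auto simp: binom_def)

theorem theorem1p9:
  fixes n t :: nat and s :: int and \<F> :: "nat set set"
  assumes "2 \<le> n" and "1 \<le> t"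
    and "\<F> \<subseteq> Pow {1..n}"
    and "t_intersecting t \<F>"
  shows "(int n - int t = 2 * s \<longrightarrow>
            sturdiness n \<F> \<le> (\<Sum>j\<in>{0..s - 1}. binom (n - 2) j)) \<and>
         (int n - int t = 2 * s + 1 \<and> int n \<ge> max (4 * (s + 2)\<^sup>2) (36 * (s + 7)) \<longrightarrow>
            sturdiness n \<F> \<le> binom (n - 4) (s - 2) + (\<Sum>j\<in>{0..s - 1}. binom (n - 2) j))"
proof (cases "s < 0")
  case True
  \<comment> \<open>Negative \<open>s\<close> means \<open>n < t\<close> in both parts, so even
    \<open>F\<close> met with itself is too small and \<open>\<F>\<close> is empty.\<close>
  have "sturdiness n \<F> = 0" if "n < t"
  proof -
    have "card F \<le> n" if "F \<in> \<F>" for F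
      using that assms(3) card_mono[of "{1..n}" F] by auto
    then have "\<F> = {}" using assms(4) \<open>n < t\<close> by (fastforce simp: t_intersecting_def)
    then show ?thesis using sturdiness_le[of 1 n 2 \<F>] assms(1) by (simp add: pair_degree_def)
  qed
  then show ?thesis using True by auto
next
  case False
  then obtain k where k: "s = int k" by (metis nat_0_le not_less)
  let ?X = "{1..n}" and ?\<G> = "(\<lambda>F. {1..n} - F) ` \<F>"
  have un: "card (G \<union> G') \<le> n - t" if "G \<in> ?\<G>" "G' \<in> ?\<G>" for G G'
    using card_union_complements[OF assms(4,3) _ that] by simp
  have transfer: "sturdiness n \<F> \<le> b" if "\<exists>i\<in>?X. \<exists>x\<in>?X. i \<noteq> x \<and> pair_degree ?\<G> i x \<le> b" for b
  proof -
    obtain i x where ix: "i \<in> ?X" "x \<in> ?X" "i \<noteq> x" "pair_degree ?\<G> i x \<le> b" using \<open>\<exists>i\<in>_. _\<close> by blast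
    then show ?thesis
      using sturdiness_le[of x n i \<F>] pair_degree_complements[OF assms(3) ix(1,2)] by simp
  qed
  show ?thesis
  proof (intro conjI impI)
    assume "int n - int t = 2 * s"
    \<comment> \<open>The strict inequality comes from \<open>1 <= t\<close>; it makes paired
      levels, of total size \<open>2 * k + 1\<close>, fit into the ground set.\<close>
    then have nt: "n - t = 2 * k" "2 * k < n" using k assms(2) by auto
    show "sturdiness n \<F> \<le> (\<Sum>j\<in>{0..s - 1}. binom (n - 2) j)"
      unfolding k sum_binom_eq
      by (rule transfer, rule exists_pair_degree_le_even[where X = ?X, simplified card_atLeastAtMost diff_Suc_1])
        (use un nt assms(1) in auto)
  next
    assume h: "int n - int t = 2 * s + 1 \<and> int n \<ge> max (4 * (s + 2)\<^sup>2) (36 * (s + 7))"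
    then have nt: "n - t = 2 * k + 1" using k by auto
    have "int (4 * (k + 2)\<^sup>2) \<le> int n" "int (36 * (k + 7)) \<le> int n"
      using h k by (auto simp: add.commute)
    then have large: "4 * (k + 2)\<^sup>2 \<le> n" "36 * (k + 7) \<le> n" by (simp_all only: of_nat_le_iff)
    show "sturdiness n \<F> \<le> binom (n - 4) (s - 2) + (\<Sum>j\<in>{0..s - 1}. binom (n - 2) j)"
      unfolding k sum_binom_eq
      by (rule transfer, rule exists_pair_degree_le_odd[where X = ?X, simplified card_atLeastAtMost diff_Suc_1])
        (use un nt large in auto)
  qed
qed

end
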